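(* Every group $G$ admits a coset correct mean (CCM).
   Context: Let $G$ be a group and $\mathcal{P}(G)$ its power set. A coset correct mean (CCM) on $G$ is a function $\mu\colon \mathcal{P}(G)\to[0,1]$ such that: (i) $\mu(G)=1$; (ii) $\mu(A\sqcup B)=\mu(A)+\mu(B)$ for all disjoint $A,B\subseteq G$; (iii) $\mu(gH)=\frac{1}{[G:H]}$ for all subgroups $H\le G$ and all $g\in G$, where $\frac{1}{[G:H]}$ is understood to be $0$ when $H$ has infinite index in $G$. *)

theory Defs
  imports Complex_Main "HOL-Algebra.Left_Coset"
begin

text \<open>
  The reciprocal \<open>1 / [G : H]\<close> of the index, with the convention that it is \<open>0\<close> if \<open>H\<close> has
  infinite index. The index counts left cosets, matching the cosets \<open>g H\<close> used below.
\<close>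
definition inverse_index :: "('a, 'b) monoid_scheme \<Rightarrow> 'a set \<Rightarrow> real" where
  "inverse_index G H =
     (if finite (lcosets\<^bsub>G\<^esub> H) then 1 / real (card (lcosets\<^bsub>G\<^esub> H)) else 0)"

text \<open>
  A mean is a HOL function on all sets over the ambient type, but only its values on subsets of
  \<open>carrier G\<close> are constrained.
\<close>
definition coset_correct_mean :: "('a, 'b) monoid_scheme \<Rightarrow> ('a set \<Rightarrow> real) \<Rightarrow> bool" where
  "coset_correct_mean G \<mu> \<longleftrightarrow>
     \<mu> \<in> Pow (carrier G) \<rightarrow> {0..1} \<and>
     \<mu> (carrier G) = 1 \<and>
     (\<forall>A B. A \<subseteq> carrier G \<longrightarrow> B \<subseteq> carrier G \<longrightarrow> A \<inter> B = {} \<longrightarrow> \<mu> (A \<union> B) = \<mu> A + \<mu> B) \<and>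
     (\<forall>H g. subgroup H G \<longrightarrow> g \<in> carrier G \<longrightarrow> \<mu> (g <#\<^bsub>G\<^esub> H) = inverse_index G H)"

end

theory Submission
  imports Defs "HOL-Analysis.Function_Topology"
begin

text \<open>
  The conditions defining a coset correct mean are closed conditions on a point of the compact
  cube of all functions from sets to \<open>[0, 1]\<close>, so it suffices to satisfy them for finitely many
  cosets at a time. For this, take a finite-index subgroup \<open>N\<close> inside all the finite-index
  subgroups involved, and the uniform measure on one representative of each coset of \<open>N\<close>, chosen
  outside the given cosets of infinite index. Such representatives exist because, by Neumann's
  lemma, finitely many cosets of infinite index cannot cover a coset of \<open>N\<close>: translates of that
  cover would cover the group.
\<close>

section \<open>Coset membership and intersections of finite-index subgroups\<close>

context group
begin

lemma mem_l_coset_iff: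
  assumes "subgroup H G" "g \<in> carrier G" "x \<in> carrier G"
  shows "x \<in> g <# H \<longleftrightarrow> inv g \<otimes> x \<in> H"
  using assms by (metis is_group subgroup.lcos_module_imp subgroup.lcos_module_rev)

lemma l_coset_eq_iff:
  assumes "subgroup H G" "g \<in> carrier G" "x \<in> carrier G"
  shows "x <# H = g <# H \<longleftrightarrow> x \<in> g <# H"
  using assms by (metis l_repr_independence lcos_self)

lemma l_coset_mem_cancel:
  assumes "subgroup H G" "g \<in> carrier G" "a \<in> carrier G" "x \<in> carrier G"
  shows "x \<in> (a \<otimes> g) <# H \<longleftrightarrow> inv a \<otimes> x \<in> g <# H"
  using assms by (simp add: mem_l_coset_iff inv_mult_group m_assoc)

lemma l_coset_Int:
  assumes "subgroup H G" "subgroup K G" "g \<in> carrier G"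
  shows "g <# (H \<inter> K) = (g <# H) \<inter> (g <# K)"
proof -
  have "x \<in> g <# (H \<inter> K) \<longleftrightarrow> x \<in> g <# H \<and> x \<in> g <# K" if "x \<in> carrier G" for x
    using assms that by (simp add: mem_l_coset_iff subgroups_Inter_pair)
  moreover have "g <# L \<subseteq> carrier G" if "subgroup L G" for L
    using assms that by (simp add: l_coset_subset_G subgroup.subset)
  ultimately show ?thesis
    using assms subgroups_Inter_pair by blast
qed

text \<open>A coset of \<open>H \<inter> K\<close> is the intersection of a coset of
  \<open>H\<close> with a coset of \<open>K\<close>, which leaves only finitely many
  candidates.\<close>

lemma finite_lcosets_Int:
  assumes "subgroup H G" "subgroup K G" "finite (lcosets H)" "finite (lcosets K)"
  shows "finite (lcosets (H \<inter> K))"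
proof (rule finite_subset)
  show "lcosets (H \<inter> K) \<subseteq> (\<lambda>(A, B). A \<inter> B) ` ((lcosets H) \<times> (lcosets K))"
    using assms by (fastforce simp: LCOSETS_def l_coset_Int)
qed (use assms in auto)

lemma finite_lcosets_carrier: "finite (lcosets (carrier G))"
proof (rule finite_subset)
  show "lcosets (carrier G) \<subseteq> {carrier G}"
    using subgroup_self l_coset_eq_iff[OF subgroup_self, of \<one>] lcos_mult_one[of "carrier G"]
    by (auto simp: LCOSETS_def)
qed simp

lemma finite_lcosets_Inter:
  assumes "finite \<H>" "\<And>H. H \<in> \<H> \<Longrightarrow> subgroup H G \<and> finite (lcosets H)"
  shows "\<exists>N. subgroup N G \<and> finite (lcosets N) \<and> (\<forall>H\<in>\<H>. N \<subseteq> H)"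
  using assms
proof (induction \<H>)
  case empty
  then show ?case
    using subgroup_self finite_lcosets_carrier by auto
next
  case (insert H \<H>)
  then obtain N where "subgroup N G" "finite (lcosets N)" "\<forall>K\<in>\<H>. N \<subseteq> K"
    by auto
  then show ?case
    using insert.prems[of H] subgroups_Inter_pair finite_lcosets_Int
    by (intro exI[of _ "H \<inter> N"]) auto
qed

section \<open>Covers by finitely many cosets\<close>

text \<open>
  B. H. Neumann. If \<open>H\<close> has infinite index, some coset \<open>g H\<close> is missing from the cover, so \<open>g H\<close>
  is covered by the cosets of the other subgroups; translating this cover replaces every coset
  of \<open>H\<close>.
\<close>
theorem neumann_coset_cover:
  assumes "finite \<H>" "\<And>H. H \<in> \<H> \<Longrightarrow> subgroup H G"
    and "finite C" "C \<subseteq> carrier G \<times> \<H>" "carrier G \<subseteq> (\<Union>(g, H)\<in>C. g <# H)"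
  shows "\<exists>H\<in>\<H>. finite (lcosets H)"
  using assms
proof (induction \<H> arbitrary: C)
  case empty
  then show ?case
    using one_closed by auto
next
  case (insert H \<H>)
  note C = \<open>C \<subseteq> carrier G \<times> insert H \<H>\<close>
  have H: "subgroup H G"
    using insert.prems(1) by blast
  have sub: "subgroup K G" if "K \<in> \<H>" for K
    using insert.prems(1) that by blast
  show ?case
  proof (rule ccontr)
    assume contra: "\<not> ?thesis"
    then have "\<not> lcosets H \<subseteq> (\<lambda>(a, K). a <# K) ` C"
      using finite_subset[OF _ finite_imageI[OF \<open>finite C\<close>]] by (metis insertI1)
    then obtain g where g: "g \<in> carrier G" and "g <# H \<notin> (\<lambda>(a, K). a <# K) ` C"
      unfolding LCOSETS_def by blast
    then have missing: "g <# H \<noteq> a <# H" if "(a, H) \<in> C" for a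
      using that by force
    define C1 where "C1 = {(a, K). (a, K) \<in> C \<and> K \<noteq> H}"
    have C1: "C1 \<subseteq> carrier G \<times> \<H>" "C1 \<subseteq> C"
      using C by (auto simp: C1_def)
    have cover1: "\<exists>(b, K)\<in>C1. x \<in> b <# K" if x: "x \<in> g <# H" for x
    proof -
      have xG: "x \<in> carrier G"
        using x g H by (meson l_coset_carrier)
      then obtain b K where bK: "(b, K) \<in> C" "x \<in> b <# K"
        using insert.prems(4) by blast
      \<comment> \<open>Cosets of \<open>H\<close> are equal or disjoint: \<open>K = H\<close> would
        force \<open>b <# H = g <# H\<close>, against \<open>missing\<close>.\<close>
      have "K \<noteq> H"
        using missing[of b] bK x xG g C H l_coset_eq_iff by (metis SigmaD1 subsetD)
      with bK show ?thesis
        by (auto simp: C1_def)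
    qed
    \<comment> \<open>Left multiplication by \<open>a \<otimes> inv g\<close> carries
      \<open>g <# H\<close> onto \<open>a <# H\<close>, and \<open>C1\<close> to a cover of it.
      Letting \<open>a\<close> range over all of \<open>C\<close> only adds surplus cosets, still of
      subgroups in \<open>\<H>\<close>.\<close>
    define C' where
      "C' = C1 \<union> (\<lambda>((a, _), (b, K)). (a \<otimes> inv g \<otimes> b, K)) ` (C \<times> C1)"
    have "finite C1"
      using \<open>finite C\<close> C1(2) finite_subset by blast
    then have "finite C'"
      using \<open>finite C\<close> by (auto simp: C'_def)
    moreover have "C' \<subseteq> carrier G \<times> \<H>"
    proof
      fix p assume "p \<in> C'"
      then consider "p \<in> C1"
        | a L b K where "(a, L) \<in> C" "(b, K) \<in> C1" "p = (a \<otimes> inv g \<otimes> b, K)"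
        by (auto simp: C'_def)
      then show "p \<in> carrier G \<times> \<H>"
        using C C1 g by cases auto
    qed
    moreover have "carrier G \<subseteq> (\<Union>(a, K)\<in>C'. a <# K)"
    proof
      fix x assume x: "x \<in> carrier G"
      then obtain a K where aK: "(a, K) \<in> C" "x \<in> a <# K"
        using insert.prems(4) by blast
      have a: "a \<in> carrier G"
        using aK C by auto
      show "x \<in> (\<Union>(a, K)\<in>C'. a <# K)"
      proof (cases "K = H")
        case False
        with aK show ?thesis
          by (auto simp: C'_def C1_def)
      next
        case True
        have "g \<otimes> inv a \<otimes> x \<in> g <# H"
          using aK True x a g H by (simp add: mem_l_coset_iff m_assoc[symmetric])
        then obtain b L where bL: "(b, L) \<in> C1" "g \<otimes> inv a \<otimes> x \<in> b <# L"
          using cover1 by blast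
        then have "b \<in> carrier G" "subgroup L G"
          using C1 sub by auto
        then have "x \<in> (a \<otimes> inv g \<otimes> b) <# L"
          using bL x a g by (simp add: l_coset_mem_cancel inv_mult_group)
        then show ?thesis
          using aK bL by (force simp: C'_def)
      qed
    qed
    ultimately have "\<exists>K\<in>\<H>. finite (lcosets K)"
      using insert.IH[of C'] sub by blast
    with contra show False
      by blast
  qed
qed

text \<open>Since \<open>N\<close> has only finitely many cosets, one translated copy of the cover
  for each of them would give a finite cover of the group by cosets of infinite-index subgroups,
  which \<open>neumann_coset_cover\<close> excludes.\<close>

lemma finite_index_coset_not_covered:
  assumes N: "subgroup N G" "finite (lcosets N)" and x: "x \<in> carrier G"
    and C: "finite C" "\<And>g H. (g, H) \<in> C \<Longrightarrow> g \<in> carrier G \<and> subgroup H G \<and> infinite (lcosets H)"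
  shows "\<not> x <# N \<subseteq> (\<Union>(g, H)\<in>C. g <# H)"
proof
  assume cover: "x <# N \<subseteq> (\<Union>(g, H)\<in>C. g <# H)"
  define rep where "rep X = (SOME y. y \<in> carrier G \<and> X = y <# N)" for X
  have rep: "rep X \<in> carrier G \<and> X = rep X <# N" if "X \<in> lcosets N" for X
    unfolding rep_def by (rule someI_ex) (use that in \<open>auto simp: LCOSETS_def\<close>)
  \<comment> \<open>Left multiplication by \<open>rep X \<otimes> inv x\<close> sends
    \<open>x <# N\<close> to \<open>X\<close>.\<close>
  define C' where "C' = (\<lambda>(X, (g, H)). (rep X \<otimes> inv x \<otimes> g, H)) ` ((lcosets N) \<times> C)"
  have "\<exists>H\<in>snd ` C. finite (lcosets H)"
  proof (rule neumann_coset_cover)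
    show "finite C'"
      using N C by (simp add: C'_def)
    show "C' \<subseteq> carrier G \<times> snd ` C"
    proof
      fix p assume "p \<in> C'"
      then obtain X g H where p: "X \<in> lcosets N" "(g, H) \<in> C" "p = (rep X \<otimes> inv x \<otimes> g, H)"
        by (auto simp: C'_def)
      then have "rep X \<in> carrier G" "g \<in> carrier G" "H \<in> snd ` C"
        using rep C by force+
      then show "p \<in> carrier G \<times> snd ` C"
        using p x by simp
    qed
    show "carrier G \<subseteq> (\<Union>(g, H)\<in>C'. g <# H)"
    proof
      fix y assume y: "y \<in> carrier G"
      then obtain X where X: "X \<in> lcosets N" "y \<in> X"
        using lcosets_part_G[OF N(1)] by blast
      have r: "rep X \<in> carrier G" "y \<in> rep X <# N"
        using rep[OF X(1)] X(2) by auto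
      have "x \<otimes> inv (rep X) \<otimes> y \<in> x <# N"
        using r x y N by (simp add: mem_l_coset_iff m_assoc[symmetric])
      then obtain g H where gH: "(g, H) \<in> C" "x \<otimes> inv (rep X) \<otimes> y \<in> g <# H"
        using cover by blast
      then have "y \<in> (rep X \<otimes> inv x \<otimes> g) <# H"
        using C(2)[OF gH(1)] r x y by (simp add: l_coset_mem_cancel inv_mult_group)
      then show "y \<in> (\<Union>(g, H)\<in>C'. g <# H)"
        using gH X by (force simp: C'_def)
    qed
  qed (use C in auto)
  with C(2) show False
    by auto
qed

section \<open>Counting cosets, and means for finitely many cosets\<close>

text \<open>Left translations permute the cosets of \<open>N\<close>, so every coset of
  \<open>H\<close> contains equally many of them; as \<open>N \<subseteq> H\<close>, these families
  partition \<open>lcosets N\<close>.\<close>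

lemma card_lcosets_within_l_coset:
  assumes N: "subgroup N G" "finite (lcosets N)" and H: "subgroup H G" "N \<subseteq> H"
    and g: "g \<in> carrier G"
  shows "card {X \<in> lcosets N. X \<subseteq> g <# H} * card (lcosets H) = card (lcosets N)"
proof -
  define Q where "Q Y = {X \<in> lcosets N. X \<subseteq> Y}" for Y
  have Nc: "N \<subseteq> carrier G" and Hc: "H \<subseteq> carrier G"
    using N H by (auto simp: subgroup.subset)
  \<comment> \<open>An inequality for arbitrary \<open>a\<close> and \<open>b\<close> suffices:
    exchanging them gives equality.\<close>
  have le: "card (Q (a <# H)) \<le> card (Q (b <# H))" if ab: "a \<in> carrier G" "b \<in> carrier G" for a b
  proof (rule card_inj_on_le)
    have sub: "X \<subseteq> carrier G" if "X \<in> lcosets N" for X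
      using lcosets_subset_PowG[OF N(1)] that by auto
    let ?c = "b \<otimes> inv a"
    show "inj_on ((<#) ?c) (Q (a <# H))"
    proof (rule inj_on_inverseI)
      fix X assume "X \<in> Q (a <# H)"
      then show "inv ?c <# (?c <# X) = X"
        using ab sub by (simp add: Q_def lcos_m_assoc lcos_mult_one)
    qed
    show "(<#) ?c ` Q (a <# H) \<subseteq> Q (b <# H)"
    proof
      fix Y assume "Y \<in> (<#) ?c ` Q (a <# H)"
      then obtain x where x: "x \<in> carrier G" "x <# N \<subseteq> a <# H" "Y = ?c <# (x <# N)"
        by (auto simp: Q_def LCOSETS_def)
      have "Y = (?c \<otimes> x) <# N"
        using x ab Nc by (simp add: lcos_m_assoc)
      moreover have "?c <# (x <# N) \<subseteq> ?c <# (a <# H)"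
        using x(2) unfolding l_coset_def by blast
      moreover have "?c <# (a <# H) = b <# H"
        using ab Hc by (simp add: lcos_m_assoc m_assoc)
      ultimately show "Y \<in> Q (b <# H)"
        using x ab by (auto simp: Q_def LCOSETS_def)
    qed
    show "finite (Q (b <# H))"
      using N by (simp add: Q_def)
  qed
  have nonempty: "X \<noteq> {}" if "X \<in> lcosets N" for X
    using that N lcos_self by (auto simp: LCOSETS_def)
  have disj: "Q Y \<inter> Q Z = {}" if "Y \<in> lcosets H" "Z \<in> lcosets H" "Y \<noteq> Z" for Y Z
    using lcos_disjoint[OF H(1) that] nonempty unfolding Q_def by blast
  have inQ: "x <# N \<in> Q (x <# H)" if "x \<in> carrier G" for x
    using that H by (auto simp: Q_def LCOSETS_def l_coset_def)
  have Un: "\<Union> (Q ` (lcosets H)) = lcosets N"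
    using inQ by (auto simp: Q_def LCOSETS_def)
  \<comment> \<open>Injectivity makes the number of classes equal to the number of cosets of
    \<open>H\<close>. Equal classes of distinct cosets would be empty, yet \<open>Q (x <# H)\<close>
    contains \<open>x <# N\<close>.\<close>
  have inj: "inj_on Q (lcosets H)"
  proof (rule inj_onI, rule ccontr)
    fix Y Z assume YZ: "Y \<in> lcosets H" "Z \<in> lcosets H" "Q Y = Q Z" "Y \<noteq> Z"
    then have "Q Y = {}"
      using disj by blast
    then show False
      using YZ(1) inQ by (auto simp: LCOSETS_def)
  qed
  have "finite (Q ` (lcosets H))"
    using Un N finite_UnionD by metis
  moreover have "card c = card (Q (g <# H))" if "c \<in> Q ` (lcosets H)" for c
    using that le g by (auto simp: LCOSETS_def intro: le_antisym)
  ultimately have "card (Q (g <# H)) * card (Q ` (lcosets H)) = card (\<Union> (Q ` (lcosets H)))"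
    using Un N(2) disj by (intro card_partition) (auto simp del: Union_iff, blast+)
  then show ?thesis
    using Un inj by (simp add: card_image flip: Q_def)
qed

text \<open>Bounds and additivity are demanded for all sets over the type, so that the means
  obtained are points of the full cube and satisfy the same closed conditions for every finite
  family.\<close>

lemma ex_mean_correct_on_finite_family:
  assumes fin: "finite C" and C: "\<And>g H. (g, H) \<in> C \<Longrightarrow> g \<in> carrier G \<and> subgroup H G"
  shows "\<exists>\<mu>. (\<forall>A. \<mu> A \<in> {0..1}) \<and> \<mu> (carrier G) = 1 \<and>
           (\<forall>A B. A \<inter> B = {} \<longrightarrow> \<mu> (A \<union> B) = \<mu> A + \<mu> B) \<and>
           (\<forall>(g, H)\<in>C. \<mu> (g <# H) = inverse_index G H)"
proof -
  define \<H> where "\<H> = {H \<in> snd ` C. finite (lcosets H)}"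
  have "finite \<H>" "\<And>H. H \<in> \<H> \<Longrightarrow> subgroup H G \<and> finite (lcosets H)"
    using fin C by (auto simp: \<H>_def)
  then obtain N where N: "subgroup N G" "finite (lcosets N)" "\<And>H. H \<in> \<H> \<Longrightarrow> N \<subseteq> H"
    using finite_lcosets_Inter by meson
  define D where "D = {(g, H) \<in> C. infinite (lcosets H)}"
  have D: "finite D"
    using fin by (rule finite_subset[rotated]) (auto simp: D_def)
  have "\<exists>y. y \<in> X \<and> y \<notin> (\<Union>(g, H)\<in>D. g <# H)" if "X \<in> lcosets N" for X
  proof -
    obtain x where x: "x \<in> carrier G" "X = x <# N"
      using \<open>X \<in> lcosets N\<close> by (auto simp: LCOSETS_def)
    have "\<not> x <# N \<subseteq> (\<Union>(g, H)\<in>D. g <# H)"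
      using C by (intro finite_index_coset_not_covered N x D) (auto simp: D_def)
    then show ?thesis
      unfolding x(2) by blast
  qed
  then obtain s where s: "\<And>X. X \<in> lcosets N \<Longrightarrow> s X \<in> X"
    and avoid: "\<And>X. X \<in> lcosets N \<Longrightarrow> s X \<notin> (\<Union>(g, H)\<in>D. g <# H)"
    by metis
  have sG: "s X \<in> carrier G" if "X \<in> lcosets N" for X
    using s[OF that] that lcosets_part_G[OF N(1)] by blast
  \<comment> \<open>The mean counts the cosets \<open>X\<close> whose sample point
    \<open>s X\<close> lies in \<open>A\<close>; disjoint sets thus count disjoint families of
    cosets.\<close>
  define \<mu> where "\<mu> A = real (card {X \<in> lcosets N. s X \<in> A}) / real (card (lcosets N))" for A
  have "lcosets N \<noteq> {}"
    by (auto simp: LCOSETS_def)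
  then have pos: "card (lcosets N) > 0"
    using N by (simp add: card_gt_0_iff)
  have "\<mu> A \<in> {0..1}" for A
  proof -
    have "card {X \<in> lcosets N. s X \<in> A} \<le> card (lcosets N)"
      using N by (intro card_mono) auto
    then show ?thesis
      using pos by (simp add: \<mu>_def)
  qed
  moreover have "\<mu> (carrier G) = 1"
  proof -
    have "{X \<in> lcosets N. s X \<in> carrier G} = lcosets N"
      using sG by blast
    then show ?thesis
      using pos by (simp add: \<mu>_def)
  qed
  moreover have "\<mu> (A \<union> B) = \<mu> A + \<mu> B" if "A \<inter> B = {}" for A B
  proof -
    have "{X \<in> lcosets N. s X \<in> A \<union> B} = {X \<in> lcosets N. s X \<in> A} \<union> {X \<in> lcosets N. s X \<in> B}"
      by blast
    moreover have "{X \<in> lcosets N. s X \<in> A} \<inter> {X \<in> lcosets N. s X \<in> B} = {}"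
      using that by blast
    ultimately show ?thesis
      using N by (simp add: \<mu>_def card_Un_disjoint add_divide_distrib)
  qed
  moreover have "\<mu> (g <# H) = inverse_index G H" if gH: "(g, H) \<in> C" for g H
  proof (cases "finite (lcosets H)")
    case True
    have g: "g \<in> carrier G" and H: "subgroup H G" "N \<subseteq> H"
      using C[OF gH] gH True N(3)[of H] by (force simp: \<H>_def)+
    \<comment> \<open>As \<open>N \<subseteq> H\<close>, a coset of \<open>N\<close> lies inside
      \<open>g <# H\<close> or misses it, so any sample point decides which.\<close>
    have "s X \<in> g <# H \<longleftrightarrow> X \<subseteq> g <# H" if X: "X \<in> lcosets N" for X
    proof
      assume mem: "s X \<in> g <# H"
      obtain x where x: "x \<in> carrier G" "X = x <# N"
        using X by (auto simp: LCOSETS_def)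
      then have "X = s X <# N"
        using s[OF X] sG[OF X] N l_coset_eq_iff by metis
      also have "\<dots> \<subseteq> s X <# H"
        using H by (auto simp: l_coset_def)
      also have "\<dots> = g <# H"
        using mem sG[OF X] g H l_coset_eq_iff by blast
      finally show "X \<subseteq> g <# H" .
    next
      assume "X \<subseteq> g <# H"
      then show "s X \<in> g <# H"
        using s[OF X] by blast
    qed
    then have "{X \<in> lcosets N. s X \<in> g <# H} = {X \<in> lcosets N. X \<subseteq> g <# H}"
      by blast
    moreover have N_eq: "real (card (lcosets N)) =
        real (card {X \<in> lcosets N. X \<subseteq> g <# H}) * real (card (lcosets H))"
      using card_lcosets_within_l_coset[OF N(1,2) H g] by (metis of_nat_mult)
    \<comment> \<open>This count is the common factor that cancels in \<open>\<mu> (g <# H)\<close>,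
      leaving the reciprocal of the number of cosets of \<open>H\<close>.\<close>
    moreover have "card {X \<in> lcosets N. X \<subseteq> g <# H} \<noteq> 0"
      using pos N_eq by (intro notI) simp
    ultimately show ?thesis
      using True pos by (auto simp: \<mu>_def inverse_index_def)
  next
    case False
    then have "(g, H) \<in> D"
      using gH by (simp add: D_def)
    \<comment> \<open>No sample point lies in a coset of infinite index from the family, so the mean
      takes the default value \<open>0\<close> of \<open>inverse_index\<close> there.\<close>
    then have empty: "{X \<in> lcosets N. s X \<in> g <# H} = {}"
      using avoid by fastforce
    show ?thesis
      unfolding \<mu>_def empty using False by (simp add: inverse_index_def)
  qed
  ultimately show ?thesis
    by (intro exI[of _ \<mu>]) auto
qed

end

section \<open>Compactness and passage to all cosets\<close>

lemma compact_unit_cube: "compact {\<mu> :: 'i \<Rightarrow> real. \<forall>i. \<mu> i \<in> {0..1}}"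
proof -
  \<comment> \<open>Tychonoff's theorem; the topology of the function type is the product
    topology.\<close>
  have "compactin (product_topology (\<lambda>i. euclidean) UNIV) (PiE UNIV (\<lambda>i :: 'i. {0..1 :: real}))"
    by (subst compactin_PiE) auto
  moreover have "PiE UNIV (\<lambda>i :: 'i. {0..1 :: real}) = {\<mu>. \<forall>i. \<mu> i \<in> {0..1}}"
    by (auto simp: PiE_UNIV_domain)
  ultimately show ?thesis
    by (simp add: euclidean_product_topology)
qed

theorem theorem1p3:
  fixes G :: "('a, 'b) monoid_scheme"
  assumes "group G"
  shows "\<exists>\<mu>. coset_correct_mean G \<mu>"
proof -
  interpret group G by fact
  define M :: "('a set \<Rightarrow> real) set" where
    "M = {\<mu>. \<forall>A. \<mu> A \<in> {0..1}} \<inter> {\<mu>. \<mu> (carrier G) = 1} \<inter>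
         {\<mu>. \<forall>A B. A \<inter> B = {} \<longrightarrow> \<mu> (A \<union> B) = \<mu> A + \<mu> B}"
  define correct :: "'a \<times> 'a set \<Rightarrow> ('a set \<Rightarrow> real) set" where
    "correct = (\<lambda>(g, H). {\<mu>. \<mu> (g <#\<^bsub>G\<^esub> H) = inverse_index G H})"
  define I where "I = carrier G \<times> {H. subgroup H G}"
  \<comment> \<open>Evaluation at a set is continuous in the product topology, so an equation
    between finitely many values of \<open>\<mu>\<close> defines a closed set.\<close>
  have closed_eq: "closed {\<mu> :: 'a set \<Rightarrow> real. \<mu> A = c}" for A c
    by (intro closed_Collect_eq continuous_intros) auto
  have "closed {\<mu> :: 'a set \<Rightarrow> real. \<mu> (A \<union> B) = \<mu> A + \<mu> B}" for A B
    by (intro closed_Collect_eq continuous_intros) auto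
  \<comment> \<open>The premise \<open>A \<inter> B = {}\<close> does not involve
    \<open>\<mu>\<close>, so each implication is either vacuous or the closed equation
    itself.\<close>
  then have "closed {\<mu> :: 'a set \<Rightarrow> real. \<forall>A B. A \<inter> B = {} \<longrightarrow> \<mu> (A \<union> B) = \<mu> A + \<mu> B}"
    by (intro closed_Collect_all closed_Collect_imp[OF open_Collect_const])
  then have "compact M"
    unfolding M_def by (intro compact_Int_closed compact_unit_cube closed_eq)
  \<comment> \<open>Finite intersection property: a finite \<open>C \<subseteq> I\<close> names
    finitely many cosets, and a mean sampled for these lies in every \<open>correct p\<close> with
    \<open>p \<in> C\<close>.\<close>
  then have "M \<inter> (\<Inter>p\<in>I. correct p) \<noteq> {}"
  proof (rule compact_imp_fip_image)
    show "closed (correct p)" for p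
      by (cases p) (simp add: correct_def closed_eq)
    fix C assume "finite C" "C \<subseteq> I"
    then obtain \<mu> where "\<mu> \<in> M" "\<forall>(g, H)\<in>C. \<mu> (g <#\<^bsub>G\<^esub> H) = inverse_index G H"
      using ex_mean_correct_on_finite_family[of C] unfolding I_def M_def by blast
    then have "\<mu> \<in> M \<inter> (\<Inter>p\<in>C. correct p)"
      by (auto simp: correct_def)
    then show "M \<inter> (\<Inter>p\<in>C. correct p) \<noteq> {}"
      by blast
  qed
  then obtain \<mu> where "\<mu> \<in> M" "\<And>p. p \<in> I \<Longrightarrow> \<mu> \<in> correct p"
    by blast
  then have "coset_correct_mean G \<mu>"
    by (force simp: coset_correct_mean_def M_def correct_def I_def)
  then show ?thesis
    by blast
qed

end
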